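(* Let $0<q<1$. For each of the four pairs $(\nabla,\triangle)$ of relations listed below, let $g^{\nabla\triangle}(z)=\sum_{n\ge 0}\sigma_{2n}^{\nabla\triangle}z^{2n}$, where $\sigma_0^{\nabla\triangle}=1$ and, for $n\ge1$, $\sigma_{2n}^{\nabla\triangle}$ is the probability that a random word $a_1a_2\cdots a_{2n}$ with independent geometrically distributed letters satisfies $a_1\nabla a_2\triangle a_3\nabla a_4\triangle\cdots\nabla a_{2n}$. Then, as power series in $z$, $$g^{\le\ge}(z)=\frac{1}{\sum_{n\ge0}\frac{(-1)^nz^{2n}}{[2n]_q!}q^{n(n-1)}},\qquad g^{\le>}(z)=\frac{1}{\sum_{n\ge0}\frac{(-1)^nz^{2n}}{[2n]_q!}},$$ $$g^{<\ge}(z)=\frac{1}{\sum_{n\ge0}\frac{(-1)^nz^{2n}}{[2n]_q!}q^{n(2n-1)}},\qquad g^{<>}(z)=\frac{1}{\sum_{n\ge0}\frac{(-1)^nz^{2n}}{[2n]_q!}q^{n^2}}.$$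
   Context: Let $p=1-q$. A random word of length $n$ is $a_1a_2\cdots a_n$ where the letters $a_i\in\{1,2,3,\dots\}$ are independent random variables with $\Pr(a_i=k)=pq^{k-1}$ for $k\ge1$. For relations $\nabla,\triangle$ on integers, the word satisfies the pattern $\nabla\triangle$ if $a_1\nabla a_2$, $a_2\triangle a_3$, $a_3\nabla a_4$, $a_4\triangle a_5$, and so on alternately. Notation: $[n]_q=\frac{1-q^n}{1-q}$, $[n]_q!=[1]_q[2]_q\cdots[n]_q$, $[0]_q!=1$. *)

theory Defs
  imports
    "HOL-Probability.Probability"
    "HOL-Computational_Algebra.Formal_Power_Series"
begin

definition q_bracket :: "real \<Rightarrow> nat \<Rightarrow> real" where
  "q_bracket q n = (1 - q ^ n) / (1 - q)"

definition q_fact :: "real \<Rightarrow> nat \<Rightarrow> real" where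
  "q_fact q n = (\<Prod>k = 1..n. q_bracket q k)"

(* The library's geometric distribution lives on {0, 1, 2, ...}; letters start at 1. *)
definition letter_pmf :: "real \<Rightarrow> nat pmf" where
  "letter_pmf q = map_pmf Suc (geometric_pmf (1 - q))"

lemma pmf_letter_pmf:
  assumes "0 < q" "q < 1" "k \<ge> 1"
  shows "pmf (letter_pmf q) k = (1 - q) * q ^ (k - 1)"
proof -
  obtain j where "k = Suc j" using assms(3) by (cases k) auto
  then show ?thesis
    using assms by (simp add: letter_pmf_def pmf_map_inj')
qed

definition random_word :: "real \<Rightarrow> nat \<Rightarrow> nat list pmf" where
  "random_word q n = replicate_pmf n (letter_pmf q)"

(* The letter a_(i+1) of the word is w ! i, so the even list positions i carry the first relation. *)
definition satisfies_pattern ::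
  "(nat \<Rightarrow> nat \<Rightarrow> bool) \<Rightarrow> (nat \<Rightarrow> nat \<Rightarrow> bool) \<Rightarrow> nat list \<Rightarrow> bool" where
  "satisfies_pattern R S w \<longleftrightarrow>
     (\<forall>i. Suc i < length w \<longrightarrow> (if even i then R else S) (w ! i) (w ! Suc i))"

definition pattern_prob ::
  "(nat \<Rightarrow> nat \<Rightarrow> bool) \<Rightarrow> (nat \<Rightarrow> nat \<Rightarrow> bool) \<Rightarrow> real \<Rightarrow> nat \<Rightarrow> real" where
  "pattern_prob R S q n =
     measure_pmf.prob (random_word q n) {w. satisfies_pattern R S w}"

lemma pattern_prob_0: "pattern_prob R S q 0 = 1"
  by (simp add: pattern_prob_def random_word_def satisfies_pattern_def)

(* The power series in z whose coefficient at z^(2 n) is c n and whose odd coefficients vanish. *)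
definition even_fps :: "(nat \<Rightarrow> real) \<Rightarrow> real fps" where
  "even_fps c = Abs_fps (\<lambda>m. if even m then c (m div 2) else 0)"

definition pattern_gf ::
  "(nat \<Rightarrow> nat \<Rightarrow> bool) \<Rightarrow> (nat \<Rightarrow> nat \<Rightarrow> bool) \<Rightarrow> real \<Rightarrow> real fps" where
  "pattern_gf R S q = even_fps (\<lambda>n. pattern_prob R S q (2 * n))"

end

theory Submission
  imports Defs
begin

text \<open>
  Words of length \<open>2 * n\<close> that carry the pattern \<open>R, \<not> S, R, \<not> S, \<dots>, R\<close> on the first \<open>2 * k\<close>
  letters and \<open>R, S, R, S, \<dots>, R\<close> on the rest have probability equal to the product of the two pattern
  probabilities. Splitting on whether \<open>S\<close> holds across the junction makes the alternating sum
  over \<open>k\<close> telescope to \<open>0\<close>, so the generating function of the pattern \<open>R, S\<close> is the inverse of the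
  signed generating function of the pattern \<open>R, \<not> S\<close>. In all four cases the latter describes
  increasing words, each step being weak or strict; conditioning on the first letter and
  using that the geometric distribution is memoryless gives their probability \<open>q ^ e / q_fact q n\<close>,
  where a strict step after the \<open>i\<close>-th letter contributes \<open>n - i\<close> to \<open>e\<close>.
\<close>

section \<open>q-factorials, and patterns with a separate relation at each gap\<close>

lemma q_fact_0 [simp]: "q_fact q 0 = 1"
  by (simp add: q_fact_def)

lemma q_fact_Suc: "q_fact q (Suc n) = q_bracket q (Suc n) * q_fact q n"
  by (simp add: q_fact_def)

text \<open>Letting the relation depend on the gap gives a class of patterns that is closed under
  removing the first letter and contains the mixtures of two patterns needed for
  telescoping.\<close>

definition fits :: "(nat \<Rightarrow> 'a \<Rightarrow> 'a \<Rightarrow> bool) \<Rightarrow> 'a list \<Rightarrow> bool" where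
  "fits G w \<longleftrightarrow> (\<forall>i. Suc i < length w \<longrightarrow> G i (w ! i) (w ! Suc i))"

lemma fits_Nil [simp]: "fits G []"
  by (simp add: fits_def)

lemma fits_Cons: "fits G (x # w) \<longleftrightarrow> (w = [] \<or> G 0 x (hd w)) \<and> fits (\<lambda>i. G (Suc i)) w"
proof -
  have all_nat: "(\<forall>i. P i) \<longleftrightarrow> P 0 \<and> (\<forall>i. P (Suc i))" for P
    by (metis not0_implies_Suc)
  have "fits G (x # w) \<longleftrightarrow> (0 < length w \<longrightarrow> G 0 x (w ! 0)) \<and>
      (\<forall>i. Suc i < length w \<longrightarrow> G (Suc i) (w ! i) (w ! Suc i))"
    unfolding fits_def by (subst all_nat) simp
  then show ?thesis
    by (cases w) (simp_all add: fits_def)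
qed

lemma satisfies_pattern_eq_fits:
  "satisfies_pattern R S = fits (\<lambda>i. if even i then R else S)"
  by (simp add: fun_eq_iff satisfies_pattern_def fits_def)

section \<open>Probability of increasing words\<close>

lemma random_word_Suc:
  "random_word q (Suc n) =
     bind_pmf (geometric_pmf (1 - q)) (\<lambda>j. map_pmf (\<lambda>w. Suc j # w) (random_word q n))"
  by (simp only: random_word_def replicate_pmf.simps letter_pmf_def bind_map_pmf
        map_pmf_def[of "\<lambda>w. Suc _ # w"])

lemma prob_random_word_Suc_sums:
  assumes "0 < q" "q < 1"
  shows "(\<lambda>j. q ^ j * (1 - q) * measure_pmf.prob (random_word q n) {w. P (Suc j # w)})
           sums measure_pmf.prob (random_word q (Suc n)) {w. P w}"
proof -
  \<comment> \<open>In \<open>ennreal\<close> the expectation over the first letter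
    \<open>Suc j\<close> is a series with no convergence obligation; \<open>sums_ennreal\<close>
    carries it back to the reals.\<close>
  have "ennreal (measure_pmf.prob (random_word q (Suc n)) {w. P w})
      = emeasure (random_word q (Suc n)) {w. P w}"
    by (simp add: measure_pmf.emeasure_eq_measure)
  also have "\<dots> = (\<Sum>j. ennreal (pmf (geometric_pmf (1 - q)) j) *
      emeasure (random_word q n) {w. P (Suc j # w)})"
    by (simp add: random_word_Suc nn_integral_measure_pmf nn_integral_count_space_nat vimage_def)
  also have "\<dots> = (\<Sum>j. ennreal (q ^ j * (1 - q) *
      measure_pmf.prob (random_word q n) {w. P (Suc j # w)}))"
    using assms by (simp add: measure_pmf.emeasure_eq_measure ennreal_mult')
  finally have "(\<lambda>j. ennreal (q ^ j * (1 - q) *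
      measure_pmf.prob (random_word q n) {w. P (Suc j # w)}))
      sums ennreal (measure_pmf.prob (random_word q (Suc n)) {w. P w})"
    by (intro sums_iff[THEN iffD2] conjI summableI) (rule sym)
  then show ?thesis
    using assms by (subst (asm) sums_ennreal) auto
qed

lemma geometric_tail_sums:
  fixes x :: real
  assumes "0 \<le> x" "x < 1"
  shows "(\<lambda>j. if c \<le> j then x ^ j else 0) sums (x ^ c / (1 - x))"
proof -
  have "(\<lambda>j. x ^ c * x ^ j) sums (x ^ c * (1 / (1 - x)))"
    using assms by (intro sums_mult geometric_sums) auto
  then have "(\<lambda>j. (\<lambda>j. if c \<le> j then x ^ j else 0) (j + c)) sums (x ^ c / (1 - x))"
    by (simp add: power_add mult.commute)
  then show ?thesis
    by (subst (asm) sums_iff_shift) simp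
qed

text \<open>The bound \<open>c\<close> makes the induction on the first letter go through.\<close>

lemma prob_chain_above:
  assumes "0 < q" "q < 1"
  shows "measure_pmf.prob (random_word q n)
           {w. (w = [] \<or> c < hd w) \<and> fits (\<lambda>i x y. x + d i \<le> y) w}
         = q ^ (c * n + (\<Sum>i<n. d i * (n - 1 - i))) / q_fact q n"
proof (induction n arbitrary: c d)
  case 0
  then show ?case
    by (simp add: random_word_def)
next
  case (Suc n)
  let ?d = "\<lambda>i. d (Suc i)"
  define s where "s = (\<Sum>i<n. ?d i * (n - 1 - i))"
  define C where "C = (1 - q) * q ^ (d 0 * n + s) / q_fact q n"
  have s: "(\<Sum>i<Suc n. d i * (Suc n - 1 - i)) = d 0 * n + s"
    by (simp add: s_def sum.lessThan_Suc_shift del: sum.lessThan_Suc)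
  \<comment> \<open>After the first letter \<open>Suc j\<close> the rest must start above
    \<open>j + d 0\<close>, so the induction hypothesis applies with that bound. Its factor
    \<open>(q ^ n) ^ j\<close> and the weight \<open>q ^ j\<close> of the letter form the ratio
    \<open>q ^ Suc n\<close>; \<open>C\<close> collects what is free of \<open>j\<close>.\<close>
  have step: "q ^ j * (1 - q) * measure_pmf.prob (random_word q n)
          {w. c < Suc j \<and> (w = [] \<or> Suc j + d 0 \<le> hd w) \<and>
              fits (\<lambda>i x y. x + ?d i \<le> y) w}
      = C * (if c \<le> j then (q ^ Suc n) ^ j else 0)" for j
  proof (cases "c \<le> j")
    case True
    then have "{w. c < Suc j \<and> (w = [] \<or> Suc j + d 0 \<le> hd w) \<and>
              fits (\<lambda>i x y. x + ?d i \<le> y) w}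
        = {w. (w = [] \<or> j + d 0 < hd w) \<and> fits (\<lambda>i x y. x + ?d i \<le> y) w}"
      by auto
    then have "q ^ j * (1 - q) * measure_pmf.prob (random_word q n)
          {w. c < Suc j \<and> (w = [] \<or> Suc j + d 0 \<le> hd w) \<and>
              fits (\<lambda>i x y. x + ?d i \<le> y) w}
       = q ^ j * (1 - q) * (q ^ ((j + d 0) * n + s) / q_fact q n)"
      using Suc.IH[of "j + d 0" ?d] by (simp add: s_def)
    also have "\<dots> = C * (q ^ Suc n) ^ j"
      by (simp add: C_def power_add power_mult power_mult_distrib algebra_simps
            flip: power_mult)
    finally show ?thesis
      using True by simp
  qed auto
  have "q ^ Suc n < 1"
    using assms by (intro power_Suc_less_one) auto
  then have "(\<lambda>j. C * (if c \<le> j then (q ^ Suc n) ^ j else 0))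
      sums (C * ((q ^ Suc n) ^ c / (1 - q ^ Suc n)))"
    using assms by (intro sums_mult geometric_tail_sums) auto
  moreover have "(\<lambda>j. C * (if c \<le> j then (q ^ Suc n) ^ j else 0)) sums
      measure_pmf.prob (random_word q (Suc n))
        {w. (w = [] \<or> c < hd w) \<and> fits (\<lambda>i x y. x + d i \<le> y) w}"
    using prob_random_word_Suc_sums[OF assms, of n
        "\<lambda>w. (w = [] \<or> c < hd w) \<and> fits (\<lambda>i x y. x + d i \<le> y) w"]
    by (simp add: fits_Cons step del: add_Suc)
  ultimately have "measure_pmf.prob (random_word q (Suc n))
        {w. (w = [] \<or> c < hd w) \<and> fits (\<lambda>i x y. x + d i \<le> y) w}
      = C * ((q ^ Suc n) ^ c / (1 - q ^ Suc n))"
    by (rule sums_unique2[symmetric])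
  also have "\<dots> = q ^ (c * Suc n + (d 0 * n + s)) / q_fact q (Suc n)"
    using assms
    by (simp add: C_def q_fact_Suc q_bracket_def power_add power_mult_distrib mult_ac
          flip: power_mult)
  finally show ?case
    by (simp only: s)
qed

lemma length_random_word: "w \<in> set_pmf (random_word q n) \<Longrightarrow> length w = n"
  by (simp add: random_word_def set_replicate_pmf)

lemma random_word_pos:
  assumes "w \<in> set_pmf (random_word q n)" "x \<in> set w"
  shows "0 < x"
proof -
  have "x \<in> set_pmf (letter_pmf q)"
    using assms by (simp add: random_word_def set_replicate_pmf in_lists_conv_set)
  then show ?thesis
    by (auto simp: letter_pmf_def)
qed

text \<open>Letters are positive, so the bound \<open>c = 0\<close> in
  \<open>prob_chain_above\<close> holds almost surely.\<close>

lemma prob_chain: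
  assumes "0 < q" "q < 1"
  shows "measure_pmf.prob (random_word q n) {w. fits (\<lambda>i x y. x + d i \<le> y) w}
         = q ^ (\<Sum>i<n. d i * (n - 1 - i)) / q_fact q n"
proof -
  have "w = [] \<or> 0 < hd w" if "w \<in> set_pmf (random_word q n)" for w
    using random_word_pos[OF that] by (cases w) auto
  then have "measure_pmf.prob (random_word q n) {w. fits (\<lambda>i x y. x + d i \<le> y) w}
      = measure_pmf.prob (random_word q n)
          {w. (w = [] \<or> 0 < hd w) \<and> fits (\<lambda>i x y. x + d i \<le> y) w}"
    by (intro measure_pmf.finite_measure_eq_AE) (auto simp: AE_measure_pmf_iff)
  also have "\<dots> = q ^ (0 * n + (\<Sum>i<n. d i * (n - 1 - i))) / q_fact q n"
    by (rule prob_chain_above[OF assms])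
  finally show ?thesis
    by (simp only: mult_0 add_0)
qed

text \<open>Even indices have the weights 2n-1, ..., 3, 1 with sum n^2, odd ones 2n-2, ..., 2, 0
  with sum n(n-1). The last index, which is no gap, has weight 0.\<close>

lemma sum_alternating_weights:
  fixes a b :: nat
  shows "(\<Sum>i<2 * n. (if even i then a else b) * (2 * n - 1 - i)) = a * n\<^sup>2 + b * (n * (n - 1))"
proof (induction n)
  case (Suc n)
  have "(\<Sum>i<2 * Suc n. (if even i then a else b) * (2 * Suc n - 1 - i))
      = a * (2 * n + 1) + b * (2 * n) + (\<Sum>i<2 * n. (if even i then a else b) * (2 * n - 1 - i))"
    by (simp add: sum.lessThan_Suc_shift del: sum.lessThan_Suc)
  then show ?case
    using Suc.IH by (cases n) (simp_all add: power2_eq_square algebra_simps)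
qed simp

lemma pattern_prob_chain:
  assumes "0 < q" "q < 1"
  shows "pattern_prob (\<lambda>x y. x + a \<le> y) (\<lambda>x y. x + b \<le> y) q (2 * n)
         = q ^ (a * n\<^sup>2 + b * (n * (n - 1))) / q_fact q (2 * n)"
proof -
  have "satisfies_pattern (\<lambda>x y. x + a \<le> y) (\<lambda>x y. x + b \<le> y)
      = fits (\<lambda>i x y. x + (if even i then a else b) \<le> y)"
    unfolding satisfies_pattern_eq_fits by (rule arg_cong[of _ _ fits]) (simp add: fun_eq_iff)
  then show ?thesis
    unfolding pattern_prob_def
    by (simp only: prob_chain[OF assms, of "2 * n" "\<lambda>i. if even i then a else b"]
          sum_alternating_weights)
qed

section \<open>Cutting words in two, and the telescoping sum\<close>

lemma prob_random_word_cong: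
  assumes "\<And>w. length w = n \<Longrightarrow> P w \<longleftrightarrow> Q w"
  shows "measure_pmf.prob (random_word q n) {w. P w} = measure_pmf.prob (random_word q n) {w. Q w}"
proof -
  have "P w \<longleftrightarrow> Q w" if "w \<in> set_pmf (random_word q n)" for w
    using assms[OF length_random_word[OF that]] .
  then show ?thesis
    by (intro measure_pmf.finite_measure_eq_AE) (auto simp: AE_measure_pmf_iff)
qed

lemma prob_random_word_append:
  "measure_pmf.prob (random_word q (m + n)) {w. P (take m w) \<and> Q (drop m w)}
   = measure_pmf.prob (random_word q m) {w. P w} * measure_pmf.prob (random_word q n) {w. Q w}"
proof -
  let ?pair = "pair_pmf (random_word q m) (random_word q n)"
  have "random_word q (m + n) = map_pmf (\<lambda>z. fst z @ snd z) ?pair"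
    unfolding random_word_def replicate_pmf_distrib pair_pmf_def map_pmf_def
    by (simp only: bind_assoc_pmf bind_return_pmf fst_conv snd_conv)
  then have "measure_pmf.prob (random_word q (m + n)) {w. P (take m w) \<and> Q (drop m w)}
      = measure_pmf.prob ?pair
          {z. P (take m (fst z @ snd z)) \<and> Q (drop m (fst z @ snd z))}"
    by (simp only: measure_map_pmf vimage_Collect_eq)
  also have "\<dots> = measure_pmf.prob ?pair ({u. P u} \<times> {v. Q v})"
  \<comment> \<open>The two events agree only almost surely: \<open>take m\<close> recovers
    \<open>fst z\<close> because words in the support have length \<open>m\<close>.\<close>
  proof (rule measure_pmf.finite_measure_eq_AE)
    have "length (fst z) = m" if "z \<in> set_pmf ?pair" for z
      using that length_random_word[of "fst z" q m] by (simp only: set_pair_pmf mem_Times_iff)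
    then show "AE z in ?pair. z \<in> {z. P (take m (fst z @ snd z)) \<and> Q (drop m (fst z @ snd z))}
        \<longleftrightarrow> z \<in> {u. P u} \<times> {v. Q v}"
      by (simp add: AE_measure_pmf_iff mem_Times_iff)
  qed simp_all
  also have "\<dots> = measure_pmf.prob (random_word q m) {w. P w} *
      measure_pmf.prob (random_word q n) {w. Q w}"
    by (rule measure_pmf_prob_product) simp_all
  finally show ?thesis .
qed

text \<open>Gap \<open>i\<close> lies between the letters with list indices \<open>i\<close> and \<open>Suc i\<close>.\<close>

definition mixed_pattern ::
  "('a \<Rightarrow> 'a \<Rightarrow> bool) \<Rightarrow> ('a \<Rightarrow> 'a \<Rightarrow> bool) \<Rightarrow> nat \<Rightarrow> nat \<Rightarrow> 'a \<Rightarrow> 'a \<Rightarrow> bool" where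
  "mixed_pattern R S k i =
     (if even i then R else if i < 2 * k then (\<lambda>x y. \<not> S x y) else S)"

definition mixed_prob ::
  "(nat \<Rightarrow> nat \<Rightarrow> bool) \<Rightarrow> (nat \<Rightarrow> nat \<Rightarrow> bool) \<Rightarrow> real \<Rightarrow> nat \<Rightarrow> nat \<Rightarrow> real" where
  "mixed_prob R S q n k =
     measure_pmf.prob (random_word q (2 * n)) {w. fits (mixed_pattern R S k) w}"

lemma mixed_prob_0: "mixed_prob R S q n 0 = pattern_prob R S q (2 * n)"
proof -
  have "mixed_pattern R S 0 = (\<lambda>i. if even i then R else S)"
    by (simp add: mixed_pattern_def fun_eq_iff)
  then show ?thesis
    by (simp add: mixed_prob_def pattern_prob_def satisfies_pattern_eq_fits)
qed

text \<open>Every odd gap of a word of length \<open>2 * Suc n\<close> has index below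
  \<open>2 * n\<close>, so \<open>S\<close> no longer occurs.\<close>

lemma mixed_prob_last:
  "mixed_prob R S q (Suc n) n = pattern_prob R (\<lambda>x y. \<not> S x y) q (2 * Suc n)"
proof -
  have "mixed_pattern R S n i = (if even i then R else (\<lambda>x y. \<not> S x y))" if "Suc i < 2 * Suc n" for i
    using that by (cases "i = 2 * n") (simp_all add: mixed_pattern_def)
  then show ?thesis
    unfolding mixed_prob_def pattern_prob_def satisfies_pattern_eq_fits
    by (intro prob_random_word_cong) (simp add: fits_def)
qed

text \<open>Cutting after \<open>m\<close> letters loses exactly the gap \<open>m - 1\<close>, the
  only one that straddles the cut.\<close>

lemma fits_take_drop_iff:
  assumes "m \<le> length w"
  shows "fits G (take m w) \<and> fits H (drop m w) \<longleftrightarrow>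
    (\<forall>i. Suc i < length w \<longrightarrow> Suc i \<noteq> m \<longrightarrow>
       (if i < m then G i else H (i - m)) (w ! i) (w ! Suc i))"
    (is "?lhs \<longleftrightarrow> ?rhs")
proof
  assume L: ?lhs
  show ?rhs
  proof (intro allI impI)
    fix i
    assume i: "Suc i < length w" "Suc i \<noteq> m"
    show "(if i < m then G i else H (i - m)) (w ! i) (w ! Suc i)"
    proof (cases "i < m")
      case True
      with L i assms show ?thesis
        by (auto simp: fits_def)
    next
      case False
      then obtain j where "i = m + j"
        by (metis le_Suc_ex not_less)
      with L i assms show ?thesis
        by (auto simp: fits_def)
    qed
  qed
next
  assume R: ?rhs
  show ?lhs
  proof
    show "fits G (take m w)"
      unfolding fits_def
    proof (intro allI impI)
      fix i
      assume "Suc i < length (take m w)"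
      then show "G i (take m w ! i) (take m w ! Suc i)"
        using R[rule_format, of i] by simp
    qed
    show "fits H (drop m w)"
      unfolding fits_def
    proof (intro allI impI)
      fix i
      assume "Suc i < length (drop m w)"
      then show "H i (drop m w ! i) (drop m w ! Suc i)"
        using R[rule_format, of "m + i"] by simp
    qed
  qed
qed

text \<open>In the product the gap between letters \<open>2 * Suc k\<close> and \<open>2 * Suc k + 1\<close> is unconstrained;
  on the right it carries \<open>\<not> S\<close> or \<open>S\<close>.\<close>

lemma pattern_prob_mult:
  assumes "Suc k < n"
  shows "pattern_prob R (\<lambda>x y. \<not> S x y) q (2 * Suc k) * pattern_prob R S q (2 * (n - Suc k))
         = mixed_prob R S q n k + mixed_prob R S q n (Suc k)"
proof -
  let ?m = "2 * Suc k"
  let ?A = "\<lambda>w. satisfies_pattern R (\<lambda>x y. \<not> S x y) (take ?m w) \<and>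
                 satisfies_pattern R S (drop ?m w)"
  let ?B = "\<lambda>k w. fits (mixed_pattern R S k) w"
  have len: "2 * n = ?m + 2 * (n - Suc k)"
    using assms by simp
  let ?gap = "Suc (2 * k)"
  \<comment> \<open>The junction is the only gap where the two mixtures differ: it carries
    \<open>S\<close> for \<open>k\<close> and the negation of \<open>S\<close> for
    \<open>Suc k\<close>.\<close>
  have gap: "mixed_pattern R S (Suc k) ?gap x y \<longleftrightarrow> \<not> mixed_pattern R S k ?gap x y" for x y
    by (auto simp: mixed_pattern_def)
  have eq: "?A w \<longleftrightarrow> ?B k w \<or> ?B (Suc k) w" if "length w = 2 * n" for w
  proof -
    \<comment> \<open>The cut is at an even position, so renumbering the gaps of the suffix keeps
      their parity.\<close>
    have pt: "(if i < ?m then if even i then R else (\<lambda>x y. \<not> S x y)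
          else if even (i - ?m) then R else S) = mixed_pattern R S k i"
      if "i \<noteq> ?gap" for i
    proof (cases "i < ?m")
      case True
      with that have "i < 2 * k \<or> i = 2 * k"
        by auto
      with True show ?thesis
        by (auto simp: mixed_pattern_def)
    next
      case False
      then have "even (i - ?m) = even i" "\<not> i < 2 * k"
        by auto
      with False show ?thesis
        by (simp add: mixed_pattern_def)
    qed
    have "?m \<le> length w"
      using that assms by simp
    then have A: "?A w \<longleftrightarrow> (\<forall>i. Suc i < length w \<longrightarrow> i \<noteq> ?gap \<longrightarrow>
        mixed_pattern R S k i (w ! i) (w ! Suc i))"
      unfolding satisfies_pattern_eq_fits fits_take_drop_iff[OF \<open>?m \<le> length w\<close>]
      by (intro iff_allI imp_cong refl) (arith, simp only: pt not_False_eq_True)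
    have other: "mixed_pattern R S (Suc k) i = mixed_pattern R S k i" if "i \<noteq> ?gap" for i
      using that by (auto simp: mixed_pattern_def fun_eq_iff less_Suc_eq)
    show ?thesis
      unfolding A fits_def by (metis other gap)
  qed
  \<comment> \<open>By \<open>Suc k < n\<close> the junction lies inside the word, so the two events
    exclude each other and their probabilities add.\<close>
  have disj: "?B (Suc k) w \<longleftrightarrow> ?B (Suc k) w \<and> \<not> ?B k w" if "length w = 2 * n" for w
  proof -
    have "Suc (Suc (2 * k)) < length w"
      using that assms by simp
    then show ?thesis
      using gap unfolding fits_def by blast
  qed
  have "pattern_prob R (\<lambda>x y. \<not> S x y) q ?m * pattern_prob R S q (2 * (n - Suc k))
      = measure_pmf.prob (random_word q (2 * n)) {w. ?A w}"
    unfolding pattern_prob_def len by (rule prob_random_word_append[symmetric])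
  also have "\<dots> = measure_pmf.prob (random_word q (2 * n)) {w. ?B k w \<or> ?B (Suc k) w \<and> \<not> ?B k w}"
    by (rule prob_random_word_cong) (use eq in blast)
  also have "{w. ?B k w \<or> ?B (Suc k) w \<and> \<not> ?B k w} =
      {w. ?B k w} \<union> {w. ?B (Suc k) w \<and> \<not> ?B k w}"
    by blast
  also have "measure_pmf.prob (random_word q (2 * n)) \<dots> = mixed_prob R S q n k +
      measure_pmf.prob (random_word q (2 * n)) {w. ?B (Suc k) w \<and> \<not> ?B k w}"
    unfolding mixed_prob_def by (rule measure_pmf.finite_measure_Union) auto
  also have "measure_pmf.prob (random_word q (2 * n)) {w. ?B (Suc k) w \<and> \<not> ?B k w}
      = mixed_prob R S q n (Suc k)"
    unfolding mixed_prob_def by (rule prob_random_word_cong) (use disj in blast)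
  finally show ?thesis .
qed

text \<open>By \<open>pattern_prob_mult\<close>, each term with 0 < k < n is
  \<open>?t k - ?t (k - 1)\<close>. The end terms have no junction: they are \<open>?t 0\<close> and
  \<open>- ?t (n - 1)\<close>, and cancel what the telescoping leaves.\<close>

lemma pattern_prob_convolution:
  assumes "0 < n"
  shows "(\<Sum>k\<le>n. (-1) ^ k * pattern_prob R (\<lambda>x y. \<not> S x y) q (2 * k) *
            pattern_prob R S q (2 * (n - k))) = 0"
    (is "sum ?f _ = 0")
proof -
  obtain m where n: "n = Suc m"
    using assms by (cases n) auto
  let ?t = "\<lambda>k. (-1) ^ k * mixed_prob R S q n k"
  have "sum ?f {..n} = ?f 0 + (\<Sum>k<m. ?f (Suc k)) + ?f n"
    by (simp only: n sum.atMost_shift sum.lessThan_Suc add.assoc)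
  also have "(\<Sum>k<m. ?f (Suc k)) = (\<Sum>k<m. ?t (Suc k) - ?t k)"
  proof (rule sum.cong)
    fix k
    assume "k \<in> {..<m}"
    then have "Suc k < n"
      by (simp add: n)
    from pattern_prob_mult[OF this, of R S q] show "?f (Suc k) = ?t (Suc k) - ?t k"
      by (simp only: mult.assoc) (simp add: algebra_simps)
  qed simp
  also have "\<dots> = ?t m - ?t 0"
    by (rule sum_lessThan_telescope)
  also have "?f 0 = ?t 0"
    by (simp add: pattern_prob_0 mixed_prob_0)
  also have "?f n = - ?t m"
    using mixed_prob_last[of R S q m] by (simp add: n pattern_prob_0)
  finally show ?thesis
    by simp
qed

section \<open>Inverting the generating function\<close>

lemma even_fps_mult: "even_fps a * even_fps b = even_fps (\<lambda>n. \<Sum>k\<le>n. a k * b (n - k))"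
proof (rule fps_ext)
  fix m
  let ?h = "\<lambda>i. fps_nth (even_fps a) i * fps_nth (even_fps b) (m - i)"
  show "fps_nth (even_fps a * even_fps b) m = fps_nth (even_fps (\<lambda>n. \<Sum>k\<le>n. a k * b (n - k))) m"
  proof (cases "even m")
    case True
    then obtain n where m: "m = 2 * n"
      by (elim evenE)
    \<comment> \<open>Odd indices contribute nothing to the Cauchy product, so only the doubles of
      \<open>{..n}\<close> remain.\<close>
    have "(\<Sum>i\<in>{0..m}. ?h i) = (\<Sum>i\<in>(*) 2 ` {..n}. ?h i)"
      by (rule sum.mono_neutral_right) (auto simp: m even_fps_def elim!: evenE)
    also have "\<dots> = (\<Sum>k\<le>n. a k * b (n - k))"
      by (subst sum.reindex)
         (auto simp: inj_on_def m even_fps_def simp flip: diff_mult_distrib2)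
    finally show ?thesis
      by (simp add: fps_mult_nth m even_fps_def)
  next
    case False
    have "fps_nth (even_fps a * even_fps b) m = 0"
      unfolding fps_mult_nth using False by (intro sum.neutral) (auto simp: even_fps_def)
    moreover have "fps_nth (even_fps c) m = 0" for c
      using False by (simp add: even_fps_def)
    ultimately show ?thesis
      by simp
  qed
qed

lemma pattern_gf_eq_inverse:
  "pattern_gf R S q = 1 / even_fps (\<lambda>n. (-1) ^ n * pattern_prob R (\<lambda>x y. \<not> S x y) q (2 * n))"
    (is "_ = 1 / ?E")
proof -
  have "(\<Sum>k\<le>n. (-1) ^ k * pattern_prob R (\<lambda>x y. \<not> S x y) q (2 * k) *
      pattern_prob R S q (2 * (n - k))) = of_bool (n = 0)" for n
    using pattern_prob_convolution[of n R S q] by (cases "n = 0") (simp_all add: pattern_prob_0)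
  then have "?E * pattern_gf R S q = even_fps (\<lambda>n. of_bool (n = 0))"
    by (simp add: pattern_gf_def even_fps_mult)
  also have "\<dots> = 1"
    by (rule fps_ext) (auto simp: even_fps_def elim!: evenE)
  finally have "inverse ?E = pattern_gf R S q"
    by (rule fps_inverse_unique)
  \<comment> \<open>A nonzero constant coefficient makes \<open>1 / ?E\<close> equal to
    \<open>inverse ?E\<close>.\<close>
  moreover have "fps_nth ?E 0 \<noteq> 0"
    by (simp add: even_fps_def pattern_prob_0)
  ultimately show ?thesis
    by (simp add: fps_divide_unit)
qed

lemma pattern_gf_chain:
  assumes "0 < q" "q < 1"
    and "R = (\<lambda>x y. x + a \<le> y)" "(\<lambda>x y. \<not> S x y) = (\<lambda>x y. x + b \<le> y)"
  shows "pattern_gf R S q =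
    1 / even_fps (\<lambda>n. (-1) ^ n / q_fact q (2 * n) * q ^ (a * n\<^sup>2 + b * (n * (n - 1))))"
  using assms(3,4) by (simp add: pattern_gf_eq_inverse pattern_prob_chain[OF assms(1,2)])

theorem theorem4:
  fixes q :: real
  assumes "0 < q" and "q < 1"
  shows "pattern_gf (\<le>) (\<ge>) q =
           1 / even_fps (\<lambda>n. (-1) ^ n / q_fact q (2 * n) * q ^ (n * (n - 1)))
         \<and> pattern_gf (\<le>) (>) q =
           1 / even_fps (\<lambda>n. (-1) ^ n / q_fact q (2 * n))
         \<and> pattern_gf (<) (\<ge>) q =
           1 / even_fps (\<lambda>n. (-1) ^ n / q_fact q (2 * n) * q ^ (n * (2 * n - 1)))
         \<and> pattern_gf (<) (>) q =
           1 / even_fps (\<lambda>n. (-1) ^ n / q_fact q (2 * n) * q ^ (n\<^sup>2))"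
proof (intro conjI)
  show "pattern_gf (\<le>) (\<ge>) q =
      1 / even_fps (\<lambda>n. (-1) ^ n / q_fact q (2 * n) * q ^ (n * (n - 1)))"
    \<comment> \<open>Here and below the first number is 0 for a weak \<open>R\<close> and 1 for a
      strict one. The second describes the negation of \<open>S\<close>: 1 for
      \<open>(\<ge>)\<close>, negated to \<open>(<)\<close>, and 0 for \<open>(>)\<close>, negated
      to \<open>(\<le>)\<close>.\<close>
    by (subst pattern_gf_chain[OF assms, of _ 0 _ 1]) (auto simp: fun_eq_iff)
  show "pattern_gf (\<le>) (>) q = 1 / even_fps (\<lambda>n. (-1) ^ n / q_fact q (2 * n))"
    by (subst pattern_gf_chain[OF assms, of _ 0 _ 0]) (auto simp: fun_eq_iff)
  have "n\<^sup>2 + n * (n - 1) = n * (2 * n - 1)" for n :: nat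
    by (cases n) (simp_all add: power2_eq_square algebra_simps)
  then show "pattern_gf (<) (\<ge>) q =
      1 / even_fps (\<lambda>n. (-1) ^ n / q_fact q (2 * n) * q ^ (n * (2 * n - 1)))"
    by (subst pattern_gf_chain[OF assms, of _ 1 _ 1]) (auto simp: fun_eq_iff)
  show "pattern_gf (<) (>) q =
      1 / even_fps (\<lambda>n. (-1) ^ n / q_fact q (2 * n) * q ^ (n\<^sup>2))"
    by (subst pattern_gf_chain[OF assms, of _ 1 _ 0]) (auto simp: fun_eq_iff)
qed

end
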